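(* Let $\mathcal{H}$ be a finite-dimensional complex Hilbert space with a fixed orthonormal basis, let $\mathcal{H}_1$ and $\mathcal{H}_2$ be two copies of $\mathcal{H}$, and let $\sigma$ be a density operator on $\mathcal{H}$ with maximum eigenvalue $\lambda_{max}$. Consider the semidefinite program over operators $Z$ on $\mathcal{H}_1\otimes\mathcal{H}_2$: $$\begin{aligned} &\underset{Z}{\text{minimize}} && \mathrm{Tr}[Z]\\ &\text{subject to} && \mathrm{Tr}_{\mathcal{H}_2}\!\left[Z(\mathbb{1}_{\mathcal{H}_1}\otimes\sigma^{\intercal})\right]\geq\sigma,\\ &&& Z\geq 0. \end{aligned}$$ Then the optimal value of this semidefinite program is $1/\lambda_{max}$.
   Context: A density operator (state) is a positive semidefinite operator of trace one. $A\geq B$ means that $A-B$ is positive semidefinite. ${}^{\intercal}$ denotes the transpose with respect to the fixed orthonormal basis of $\mathcal{H}$. $\mathrm{Tr}_{\mathcal{H}_2}$ denotes the partial trace over the second tensor factor; the resulting operator on $\mathcal{H}_1$ is compared with $\sigma$ under the identification $\mathcal{H}_1=\mathcal{H}$. *)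

theory Defs
  imports "HOL-Analysis.Analysis"
begin

text \<open>
  The space \<open>\<H>\<close> with its fixed orthonormal basis is \<open>complex ^ 'n\<close>; operators are given by
  their matrices, and \<open>\<H>\<^sub>1 \<otimes> \<H>\<^sub>2\<close> has the product basis, indexed by \<open>'n \<times> 'n\<close>.
\<close>

definition cinner_vec :: "complex ^ 'n \<Rightarrow> complex ^ 'n \<Rightarrow> complex" where
  "cinner_vec x y = (\<Sum>i\<in>UNIV. cnj (x $ i) * y $ i)"

definition conj_transpose :: "complex ^ 'n ^ 'm \<Rightarrow> complex ^ 'm ^ 'n" where
  "conj_transpose A = (\<chi> i j. cnj (A $ j $ i))"

definition psd :: "complex ^ 'n ^ 'n \<Rightarrow> bool" where
  "psd A \<longleftrightarrow> conj_transpose A = A \<and> (\<forall>x. 0 \<le> Re (cinner_vec x (A *v x)))"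

definition loewner_ge :: "complex ^ 'n ^ 'n \<Rightarrow> complex ^ 'n ^ 'n \<Rightarrow> bool" where
  "loewner_ge A B \<longleftrightarrow> psd (A - B)"

definition density_operator :: "complex ^ 'n ^ 'n \<Rightarrow> bool" where
  "density_operator A \<longleftrightarrow> psd A \<and> trace A = 1"

definition eigenvalue :: "complex ^ 'n ^ 'n \<Rightarrow> complex \<Rightarrow> bool" where
  "eigenvalue A c \<longleftrightarrow> (\<exists>v. v \<noteq> 0 \<and> A *v v = c *s v)"

text \<open>Meant for Hermitian \<open>A\<close>, all of whose eigenvalues are real.\<close>

definition max_eigenvalue :: "complex ^ 'n ^ 'n \<Rightarrow> real \<Rightarrow> bool" where
  "max_eigenvalue A l \<longleftrightarrow>
     eigenvalue A (complex_of_real l) \<and> (\<forall>m. eigenvalue A (complex_of_real m) \<longrightarrow> m \<le> l)"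

definition tensor_mat ::
    "complex ^ 'n ^ 'n \<Rightarrow> complex ^ 'm ^ 'm \<Rightarrow> complex ^ ('n \<times> 'm) ^ ('n \<times> 'm)" where
  "tensor_mat A B = (\<chi> p q. A $ fst p $ fst q * B $ snd p $ snd q)"

definition partial_trace_2 :: "complex ^ ('n::finite \<times> 'm::finite) ^ ('n \<times> 'm) \<Rightarrow> complex ^ 'n ^ 'n" where
  "partial_trace_2 Z = (\<chi> i j. \<Sum>k\<in>UNIV. Z $ (i, k) $ (j, k))"

definition sdp_feasible :: "complex ^ 'n ^ 'n \<Rightarrow> (complex ^ ('n \<times> 'n) ^ ('n \<times> 'n)) set" where
  "sdp_feasible \<sigma> =
     {Z. loewner_ge (partial_trace_2 (Z ** tensor_mat (mat 1) (transpose \<sigma>))) \<sigma> \<and> psd Z}"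

text \<open>
  The trace of a feasible \<open>Z\<close> is real, so \<open>Re\<close> loses nothing. The infimum is taken in \<open>ereal\<close>,
  so that an infeasible program has value \<open>\<infinity>\<close> and an unbounded one \<open>-\<infinity>\<close>.
\<close>

definition sdp_value :: "complex ^ 'n ^ 'n \<Rightarrow> ereal" where
  "sdp_value \<sigma> = (INF Z\<in>sdp_feasible \<sigma>. ereal (Re (trace Z)))"

end

theory Submission
  imports Defs
begin

text \<open>
  Lower bound: taking the trace of the constraint gives
  \<open>1 \<le> Tr[Z (1 \<otimes> \<sigma>\<^sup>T)] \<le> \<lambda>\<^sub>m\<^sub>a\<^sub>x Tr[Z]\<close>, because \<open>\<lambda>\<^sub>m\<^sub>a\<^sub>x 1 - \<sigma>\<^sup>T\<close> and \<open>Z\<close> are positive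
  semidefinite and the trace of a product of two such matrices is nonnegative.
  The bound is attained at \<open>Z = \<sigma> \<otimes> (v v\<^sup>*)\<^sup>T / \<lambda>\<^sub>m\<^sub>a\<^sub>x\<close>, where \<open>v\<close> is a unit eigenvector of \<open>\<sigma>\<close> for
  \<open>\<lambda>\<^sub>m\<^sub>a\<^sub>x\<close>.
\<close>

section \<open>Sesquilinear algebra of \<open>cinner_vec\<close> and matrix action\<close>

lemma cinner_vec_diff:
  "cinner_vec (x - y) z = cinner_vec x z - cinner_vec y z"
  "cinner_vec z (x - y) = cinner_vec z x - cinner_vec z y"
  by (simp_all add: cinner_vec_def algebra_simps sum_subtractf)

lemma cinner_vec_scale:
  "cinner_vec (c *s x) z = cnj c * cinner_vec x z"
  "cinner_vec z (c *s x) = c * cinner_vec z x"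
  by (simp_all add: cinner_vec_def sum_distrib_left mult_ac)

lemma cnj_cinner_vec: "cnj (cinner_vec x y) = cinner_vec y x"
  by (simp add: cinner_vec_def mult.commute)

lemma cinner_vec_self: "cinner_vec x x = complex_of_real ((norm x)\<^sup>2)"
  by (simp add: cinner_vec_def norm_vec_def L2_set_def sum_nonneg mult.commute[of "cnj _"]
      flip: complex_norm_square)

lemma cinner_vec_axis: "cinner_vec (axis i 1) x = x $ i"
  by (simp add: cinner_vec_def axis_def if_distrib if_distribR cong: if_cong)

lemma cinner_vec_matrix:
  "cinner_vec x (A *v y) = (\<Sum>i\<in>UNIV. \<Sum>j\<in>UNIV. cnj (x $ i) * A $ i $ j * y $ j)"
  by (simp add: cinner_vec_def matrix_vector_mult_def sum_distrib_left mult.assoc)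

lemma matrix_scale_vector: "A *v (c *s x) = c *s (A *v (x :: complex ^ 'n))"
  by (simp add: vec_eq_iff matrix_vector_mult_def sum_distrib_left mult_ac)

lemma scalar_matrix_vector: "mat c *v x = c *s (x :: complex ^ 'n)"
  by (simp add: vec_eq_iff matrix_vector_mult_def mat_def if_distrib if_distribR cong: if_cong)

lemma cinner_vec_hermitian:
  assumes "conj_transpose A = A"
  shows "cinner_vec (A *v x) y = cinner_vec x (A *v y)"
proof -
  have h: "cnj (A $ i $ j) = A $ j $ i" for i j
    using arg_cong[OF assms, of "\<lambda>M. M $ j $ i"] by (simp add: conj_transpose_def)
  have "cinner_vec (A *v x) y = (\<Sum>i\<in>UNIV. \<Sum>j\<in>UNIV. cnj (x $ j) * A $ j $ i * y $ i)"
    by (simp add: cinner_vec_def matrix_vector_mult_def sum_distrib_left sum_distrib_right h mult_ac)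
  also have "\<dots> = cinner_vec x (A *v y)"
    unfolding cinner_vec_matrix by (rule sum.swap)
  finally show ?thesis .
qed

section \<open>Positive semidefinite matrices: kernel, entries, elimination, trace of a
  product\<close>

lemma psd_nonneg: "psd A \<Longrightarrow> 0 \<le> Re (cinner_vec x (A *v x))"
  by (simp add: psd_def)

text \<open>Moving from \<open>x\<close> to \<open>x - t A x\<close> changes the form by
  \<open>- 2 t |A x|^2\<close> plus a term quadratic in \<open>t\<close>, so for small
  \<open>t > 0\<close> it would become negative unless \<open>A x = 0\<close>.\<close>

lemma psd_kernel:
  assumes "psd A" and zero: "Re (cinner_vec x (A *v x)) = 0"
  shows "A *v x = 0"
proof (rule ccontr)
  define y where "y = A *v x"
  define r where "r = (norm y)\<^sup>2"
  define s where "s = Re (cinner_vec y (A *v y))"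
  \<comment> \<open>Small enough that \<open>t * s \<le> r < 2 * r\<close>; the \<open>+ 1\<close>
    keeps the denominator positive when \<open>s = 0\<close>.\<close>
  define t where "t = r / (s + 1)"
  assume "A *v x \<noteq> 0"
  then have r: "r > 0" by (simp add: r_def y_def)
  have s: "s \<ge> 0" using psd_nonneg[OF assms(1)] by (simp add: s_def)
  have t: "t > 0" using r s by (simp add: t_def)
  have sym: "cinner_vec x (A *v y) = complex_of_real r"
    using cinner_vec_hermitian[of A x y] assms(1) cinner_vec_self[of y]
    by (simp add: psd_def y_def r_def)
  have "0 \<le> Re (cinner_vec (x - complex_of_real t *s y) (A *v (x - complex_of_real t *s y)))"
    by (rule psd_nonneg[OF assms(1)])
  also have "\<dots> = t * (t * s - 2 * r)"
    using zero sym cinner_vec_self[of y]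
    by (simp add: matrix_vector_mult_diff_distrib matrix_scale_vector cinner_vec_diff
        cinner_vec_scale s_def r_def algebra_simps flip: y_def)
  finally have "t * s - 2 * r \<ge> 0" using t by (simp add: zero_le_mult_iff)
  moreover have "t * s \<le> r" using r s by (simp add: t_def field_simps)
  ultimately show False using r by simp
qed

lemma psd_entry_sym: "psd A \<Longrightarrow> cnj (A $ i $ j) = A $ j $ i"
  by (simp add: psd_def conj_transpose_def vec_eq_iff)

lemma matrix_vector_axis: "(A *v axis j 1) = (column j A :: complex ^ 'n)"
  by (simp add: vec_eq_iff matrix_vector_mult_def axis_def column_def if_distrib cong: if_cong)

lemma psd_diag: "psd A \<Longrightarrow> 0 \<le> Re (A $ i $ i)"
  using psd_nonneg[of A "axis i 1"] by (simp add: cinner_vec_axis matrix_vector_axis column_def)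

lemma psd_diag_real: "psd A \<Longrightarrow> complex_of_real (Re (A $ i $ i)) = A $ i $ i"
  using psd_entry_sym[of A i i] by (simp add: complex_eq_iff)

text \<open>The diagonal entry is the value of the form at a basis vector, so
  \<open>psd_kernel\<close> applies to that vector, whose image is column \<open>i\<close>.\<close>

lemma psd_diag_zero:
  assumes "psd A" "A $ i $ i = 0"
  shows "A $ j $ i = 0"
proof -
  have "A *v axis i 1 = 0"
    by (rule psd_kernel[OF assms(1)])
       (simp add: matrix_vector_axis cinner_vec_axis column_def assms(2))
  then show ?thesis by (simp add: matrix_vector_axis column_def vec_eq_iff)
qed

lemma psd_trace_nonneg: "psd A \<Longrightarrow> 0 \<le> Re (trace A)"
  by (simp add: trace_def sum_nonneg psd_diag)

lemma psd_transpose: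
  assumes "psd A"
  shows "psd (transpose A)"
proof -
  \<comment> \<open>Transposing amounts to evaluating the form of \<open>A\<close> at the entrywise
    conjugate vector.\<close>
  have "cinner_vec x (transpose A *v x) = cinner_vec (\<chi> i. cnj (x $ i)) (A *v (\<chi> i. cnj (x $ i)))" for x
    unfolding cinner_vec_matrix by (subst sum.swap) (simp add: transpose_def mult_ac)
  moreover have "conj_transpose (transpose A) = transpose A"
    using psd_entry_sym[OF assms] by (simp add: conj_transpose_def transpose_def vec_eq_iff)
  ultimately show ?thesis using psd_nonneg[OF assms] by (simp add: psd_def)
qed

text \<open>This is the Schur complement of the pivot \<open>A $ i $ i\<close>, padded with zeros.
  Completing the square shows that its form at \<open>x\<close> is that of \<open>A\<close> at
  \<open>x\<close> shifted along the \<open>i\<close>-th basis vector.\<close>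

lemma psd_eliminate:
  assumes "psd A" and ii: "A $ i $ i \<noteq> 0"
  shows "psd (\<chi> j k. A $ j $ k - A $ j $ i * A $ i $ k / A $ i $ i)" (is "psd ?B")
proof -
  define a where "a = Re (A $ i $ i)"
  have a: "A $ i $ i = complex_of_real a"
    using psd_diag_real[OF assms(1)] by (simp add: a_def)
  have a0: "a \<noteq> 0" using ii a by simp
  have "conj_transpose ?B = ?B"
    using psd_entry_sym[OF assms(1)] by (simp add: conj_transpose_def vec_eq_iff mult.commute)
  moreover have "0 \<le> Re (cinner_vec x (?B *v x))" for x
  proof -
    define z where "z = (\<Sum>k\<in>UNIV. A $ i $ k * x $ k)"
    \<comment> \<open>The shift for which the \<open>i\<close>-th entry of
      \<open>A *v (x - w *s axis i 1)\<close> vanishes.\<close>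
    define w where "w = z / complex_of_real a"
    have z: "cinner_vec (axis i 1) (A *v x) = z"
      by (simp add: z_def cinner_vec_axis matrix_vector_mult_def)
    have z': "cinner_vec x (A *v axis i 1) = cnj z"
      using cinner_vec_hermitian[of A x "axis i 1"] z assms(1)
        cnj_cinner_vec[of "axis i 1" "A *v x"]
      by (simp add: psd_def)
    have q: "cinner_vec (axis i 1) (A *v axis i 1) = complex_of_real a"
      by (simp add: cinner_vec_axis matrix_vector_axis column_def a)
    have "?B *v x = A *v x - w *s (A *v axis i 1)"
      by (simp add: vec_eq_iff matrix_vector_mult_def algebra_simps sum_subtractf z_def w_def a
          sum_distrib_left sum_divide_distrib axis_def if_distrib cong: if_cong)
    then have "cinner_vec x (?B *v x) = cinner_vec x (A *v x) - w * cnj z"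
      by (simp add: cinner_vec_diff cinner_vec_scale z')
    also have "\<dots> = cinner_vec (x - w *s axis i 1) (A *v (x - w *s axis i 1))"
      by (simp add: matrix_vector_mult_diff_distrib matrix_scale_vector cinner_vec_diff
          cinner_vec_scale z z' q) (simp add: w_def a0)
    finally show ?thesis using psd_nonneg[OF assms(1)] by simp
  qed
  ultimately show ?thesis by (simp add: psd_def)
qed

text \<open>
  Cholesky elimination writes \<open>A\<close> as a sum of rank-one matrices without the spectral theorem;
  each step decreases the number of nonzero diagonal entries.
\<close>

lemma trace_mult_psd_nonneg:
  assumes "psd W" and "psd A"
  shows "0 \<le> Re (trace (W ** A))"
  using assms(2)
proof (induction "card {i. A $ i $ i \<noteq> 0}" arbitrary: A rule: less_induct)
  case less
  show ?case
  proof (cases "\<forall>i. A $ i $ i = 0")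
    case True
    then have "A $ j $ i = 0" for i j using psd_diag_zero[OF less.prems] by blast
    then show ?thesis by (simp add: trace_def matrix_matrix_mult_def)
  next
    case False
    then obtain i where i: "A $ i $ i \<noteq> 0" by blast
    define B where "B = (\<chi> j k. A $ j $ k - A $ j $ i * A $ i $ k / A $ i $ i)"
    have B: "psd B" unfolding B_def by (rule psd_eliminate[OF less.prems i])
    \<comment> \<open>A zero diagonal entry of \<open>A\<close> has a zero column, so the correction
      term vanishes there too; the pivot itself becomes zero.\<close>
    have "{j. B $ j $ j \<noteq> 0} \<subset> {j. A $ j $ j \<noteq> 0}"
    proof (rule psubsetI)
      show "{j. B $ j $ j \<noteq> 0} \<subseteq> {j. A $ j $ j \<noteq> 0}"
        using psd_diag_zero[OF less.prems] by (auto simp: B_def)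
      have "i \<notin> {j. B $ j $ j \<noteq> 0}" by (simp add: B_def)
      then show "{j. B $ j $ j \<noteq> 0} \<noteq> {j. A $ j $ j \<noteq> 0}" using i by blast
    qed
    then have "card {j. B $ j $ j \<noteq> 0} < card {j. A $ j $ j \<noteq> 0}"
      by (intro psubset_card_mono) auto
    from less.hyps[OF this B] have IH: "0 \<le> Re (trace (W ** B))" .
    \<comment> \<open>The eliminated part is the rank-one matrix \<open>u u^* / A $ i $ i\<close>
      with \<open>u = column i A\<close>, and its trace against \<open>W\<close> is a value of the
      form of \<open>W\<close>.\<close>
    have "trace (W ** A) = trace (W ** B) + cinner_vec (column i A) (W *v column i A) / A $ i $ i"
      by (simp add: trace_def matrix_matrix_mult_def cinner_vec_matrix B_def column_def
          psd_entry_sym[OF less.prems] sum_divide_distrib algebra_simps flip: sum.distrib)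
    also have "\<dots> = trace (W ** B)
        + cinner_vec (column i A) (W *v column i A) / complex_of_real (Re (A $ i $ i))"
      by (simp add: psd_diag_real[OF less.prems])
    finally show ?thesis
      using IH psd_nonneg[OF assms(1), of "column i A"] psd_diag[OF less.prems, of i] by simp
  qed
qed

section \<open>Identity tensor factors and the largest eigenvalue\<close>

lemma sum_UNIV_prod:
  fixes f :: "'a::finite \<times> 'b::finite \<Rightarrow> 'c::comm_monoid_add"
  shows "(\<Sum>p\<in>UNIV. f p) = (\<Sum>i\<in>UNIV. \<Sum>k\<in>UNIV. f (i, k))"
  by (simp add: sum.cartesian_product)

text \<open>The matrix is block diagonal with copies of \<open>A\<close>, so its form is a sum of
  forms of \<open>A\<close> over the slices of \<open>x\<close>.\<close>

lemma psd_tensor_one: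
  assumes "psd A"
  shows "psd (tensor_mat (mat 1 :: complex ^ 'm ^ 'm) A)" (is "psd ?T")
proof -
  have "conj_transpose ?T = ?T"
    using psd_entry_sym[OF assms]
    by (auto simp: conj_transpose_def tensor_mat_def mat_def vec_eq_iff)
  moreover have "cinner_vec x (?T *v x) =
      (\<Sum>i\<in>UNIV. cinner_vec (\<chi> k. x $ (i, k)) (A *v (\<chi> k. x $ (i, k))))" for x
  proof -
    have "(\<Sum>j\<in>UNIV. \<Sum>l\<in>UNIV. cnj (x $ (i, k)) * ((if i = j then 1 else 0) * A $ k $ l) * x $ (j, l))
        = (\<Sum>l\<in>UNIV. cnj (x $ (i, k)) * A $ k $ l * x $ (i, l))" for i k
      by (subst sum.swap) (simp add: if_distrib if_distribR cong: if_cong)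
    then show ?thesis
      by (simp add: cinner_vec_matrix tensor_mat_def mat_def sum_UNIV_prod)
  qed
  ultimately show ?thesis
    using psd_nonneg[OF assms] by (simp add: psd_def sum_nonneg)
qed

text \<open>A maximiser of the Rayleigh quotient of \<open>A\<close> is an eigenvector.\<close>

lemma psd_max_eigenvalue_diff:
  assumes herm: "conj_transpose A = A" and max: "max_eigenvalue A l"
  shows "psd (mat (complex_of_real l) - A)"
proof -
  define f where "f x = Re (cinner_vec x (A *v x))" for x
  have "continuous_on (sphere 0 1) f"
    unfolding f_def cinner_vec_matrix by (intro continuous_intros)
  moreover have "sphere 0 1 \<noteq> ({} :: (complex ^ 'a) set)"
  proof -
    have "norm (axis undefined 1 :: complex ^ 'a) = 1" by simp
    then show ?thesis by (metis mem_sphere_0 empty_iff)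
  qed
  ultimately obtain x where x: "norm x = 1" and xmax: "\<And>y. norm y = 1 \<Longrightarrow> f y \<le> f x"
    using continuous_attains_sup[of "sphere 0 1" f] by auto
  have quad: "Re (cinner_vec y ((mat (complex_of_real c) - A) *v y)) = c * (norm y)\<^sup>2 - f y" for c y
    by (simp add: matrix_vector_mult_diff_rdistrib scalar_matrix_vector cinner_vec_diff
        cinner_vec_scale cinner_vec_self f_def)
  have hermd: "conj_transpose (mat (complex_of_real c) - A) = mat (complex_of_real c) - A" for c
    using herm by (auto simp: conj_transpose_def mat_def vec_eq_iff)
  \<comment> \<open>Quadratic homogeneity carries the maximum over the unit sphere to all
    vectors.\<close>
  have le: "f y \<le> f x * (norm y)\<^sup>2" for y
  proof (cases "y = 0")
    case True
    then show ?thesis by (simp add: f_def cinner_vec_def)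
  next
    case False
    define u where "u = complex_of_real (inverse (norm y)) *s y"
    have "cinner_vec u u = complex_of_real (inverse (norm y) * (inverse (norm y) * (norm y)\<^sup>2))"
      by (simp add: u_def cinner_vec_scale cinner_vec_self[of y])
    also have "inverse (norm y) * (inverse (norm y) * (norm y)\<^sup>2) = 1"
      using False by (simp add: power2_eq_square field_simps)
    finally have "(norm u)\<^sup>2 = 1\<^sup>2"
      by (simp only: cinner_vec_self of_real_eq_iff one_power2)
    then have "norm u = 1" by (rule power2_eq_imp_eq) simp_all
    from xmax[OF this] have "f u \<le> f x" .
    moreover have "f u = f y / (norm y)\<^sup>2"
      by (simp add: f_def u_def matrix_scale_vector cinner_vec_scale power2_eq_square field_simps)
    ultimately show ?thesis using False by (simp add: field_simps)
  qed
  have "psd (mat (complex_of_real (f x)) - A)"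
    unfolding psd_def using hermd le by (simp add: quad)
  \<comment> \<open>The form of this positive semidefinite matrix vanishes at the maximiser, which
    turns maximality into the eigenvector equation.\<close>
  then have "(mat (complex_of_real (f x)) - A) *v x = 0"
    by (rule psd_kernel) (simp add: quad x)
  then have "A *v x = complex_of_real (f x) *s x"
    by (simp add: matrix_vector_mult_diff_rdistrib scalar_matrix_vector)
  moreover have "x \<noteq> 0" using x by auto
  ultimately have "eigenvalue A (complex_of_real (f x))" by (auto simp: eigenvalue_def)
  then have "f x \<le> l" using max by (simp add: max_eigenvalue_def)
  then have "f y \<le> l * (norm y)\<^sup>2" for y
    using le[of y] mult_right_mono[of "f x" l "(norm y)\<^sup>2"] by simp
  then show ?thesis unfolding psd_def using hermd by (simp add: quad)
qed

section \<open>Tensor products, traces and partial traces\<close>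

lemma trace_partial_trace_2: "trace (partial_trace_2 Z) = trace Z"
  by (simp add: trace_def partial_trace_2_def UNIV_Times_UNIV[symmetric]
        sum.cartesian_product del: UNIV_Times_UNIV)

lemma tensor_mat_mult:
  "tensor_mat A B ** tensor_mat C D = tensor_mat (A ** C) (B ** D)"
  by (simp add: vec_eq_iff tensor_mat_def matrix_matrix_mult_def sum_product mult_ac
        UNIV_Times_UNIV[symmetric] sum.cartesian_product split_def del: UNIV_Times_UNIV)

lemma partial_trace_2_tensor_mat:
  "partial_trace_2 (tensor_mat A B) = (\<chi> i j. trace B * A $ i $ j)"
  by (simp add: vec_eq_iff partial_trace_2_def tensor_mat_def trace_def sum_distrib_left
        sum_distrib_right mult_ac)

lemma trace_tensor_mat: "trace (tensor_mat A B) = trace A * trace B"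
  by (simp add: trace_def tensor_mat_def sum_product
        UNIV_Times_UNIV[symmetric] sum.cartesian_product split_def del: UNIV_Times_UNIV)

text \<open>The second factor is \<open>c\<close> times the transpose of \<open>v v^*\<close>.
  Contracting the second index of \<open>x\<close> with \<open>v\<close> gives a vector
  \<open>y\<close>, and the form becomes \<open>c\<close> times that of \<open>A\<close> at
  \<open>y\<close>.\<close>

lemma psd_tensor_rank_one:
  fixes A :: "complex ^ 'n ^ 'n" and v :: "complex ^ 'm"
  assumes "psd A" and "0 \<le> c"
  shows "psd (tensor_mat A (\<chi> k l. complex_of_real c * cnj (v $ k) * v $ l))" (is "psd ?T")
proof -
  have "conj_transpose ?T = ?T"
    using psd_entry_sym[OF assms(1)]
    by (simp add: conj_transpose_def tensor_mat_def vec_eq_iff mult_ac)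
  moreover have "0 \<le> Re (cinner_vec x (?T *v x))" for x
  proof -
    define y where "y = (\<chi> i. \<Sum>k\<in>UNIV. v $ k * x $ (i, k))"
    have "cinner_vec x (?T *v x) = (\<Sum>i\<in>UNIV. \<Sum>k\<in>UNIV. \<Sum>j\<in>UNIV. \<Sum>l\<in>UNIV.
        cnj (x $ (i, k)) * (A $ i $ j * (complex_of_real c * cnj (v $ k) * v $ l)) * x $ (j, l))"
      by (simp add: cinner_vec_matrix tensor_mat_def sum_UNIV_prod)
    also have "\<dots> = (\<Sum>i\<in>UNIV. \<Sum>j\<in>UNIV. \<Sum>k\<in>UNIV. \<Sum>l\<in>UNIV.
        cnj (x $ (i, k)) * (A $ i $ j * (complex_of_real c * cnj (v $ k) * v $ l)) * x $ (j, l))"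
      by (intro sum.cong refl sum.swap)
    also have "\<dots> = complex_of_real c * cinner_vec y (A *v y)"
      by (simp add: cinner_vec_matrix y_def sum_distrib_left sum_distrib_right mult_ac)
    finally show ?thesis using psd_nonneg[OF assms(1)] assms(2) by simp
  qed
  ultimately show ?thesis by (simp add: psd_def)
qed

section \<open>Lower bound, attaining witness and optimal value\<close>

lemma sdp_feasible_trace_ge:
  fixes \<sigma> :: "complex ^ 'n ^ 'n"
  assumes dens: "density_operator \<sigma>" and max: "max_eigenvalue \<sigma> l" and Z: "Z \<in> sdp_feasible \<sigma>"
  shows "1 \<le> l * Re (trace Z)"
proof -
  define M where "M = mat (complex_of_real l) - \<sigma>"
  let ?T = "tensor_mat (mat 1 :: complex ^ 'n ^ 'n)"
  have "psd M"
    unfolding M_def using dens max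
    by (intro psd_max_eigenvalue_diff) (simp_all add: density_operator_def psd_def)
  then have "psd (?T (transpose M))" by (intro psd_tensor_one psd_transpose)
  moreover have psdZ: "psd Z" using Z by (simp add: sdp_feasible_def)
  ultimately have ge: "0 \<le> Re (trace (Z ** ?T (transpose M)))"
    by (intro trace_mult_psd_nonneg)
  have "?T (transpose M) = mat (complex_of_real l) - ?T (transpose \<sigma>)"
    by (auto simp: M_def vec_eq_iff tensor_mat_def transpose_def mat_def)
  then have "Z ** ?T (transpose M) = Z ** mat (complex_of_real l) - Z ** ?T (transpose \<sigma>)"
    by (simp only:) (simp add: matrix_matrix_mult_def vec_eq_iff right_diff_distrib sum_subtractf)
  moreover have "trace (Z ** mat (complex_of_real l)) = complex_of_real l * trace Z"
    by (simp add: trace_def matrix_matrix_mult_def mat_def sum_distrib_left mult.commute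
        if_distrib if_distribR cong: if_cong)
  ultimately have "Re (trace (Z ** ?T (transpose \<sigma>))) \<le> l * Re (trace Z)"
    using ge by (simp add: trace_sub)
  \<comment> \<open>The trace of the constraint; the partial trace preserves traces and
    \<open>\<sigma>\<close> has trace one.\<close>
  moreover have "0 \<le> Re (trace (partial_trace_2 (Z ** ?T (transpose \<sigma>)) - \<sigma>))"
    using Z by (intro psd_trace_nonneg) (simp add: sdp_feasible_def loewner_ge_def)
  then have "1 \<le> Re (trace (Z ** ?T (transpose \<sigma>)))"
    using dens by (simp add: trace_sub trace_partial_trace_2 density_operator_def)
  ultimately show ?thesis by linarith
qed

text \<open>The trace of \<open>l 1 - \<sigma>\<close> is nonnegative, so \<open>l\<close> times the
  dimension is at least one. This permits division by \<open>l\<close>.\<close>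

lemma max_eigenvalue_density_pos:
  fixes \<sigma> :: "complex ^ 'n ^ 'n"
  assumes "density_operator \<sigma>" "max_eigenvalue \<sigma> l"
  shows "0 < l"
proof -
  have "psd (mat (complex_of_real l) - \<sigma>)"
    using assms by (intro psd_max_eigenvalue_diff) (simp_all add: density_operator_def psd_def)
  from psd_trace_nonneg[OF this] have "1 \<le> real CARD('n) * l"
    using assms(1) by (simp add: trace_sub density_operator_def) (simp add: trace_def mat_def)
  then show ?thesis by (smt (verit) mult_nonneg_nonpos of_nat_0_le_iff)
qed

text \<open>The eigenvector is not assumed normalised, hence \<open>(norm v)^2\<close> in
  \<open>c\<close>. The second factor has trace \<open>1 / l\<close>, while its product with the
  transpose of \<open>\<sigma>\<close> has trace one, since \<open>v\<close> contributes the
  eigenvalue \<open>l\<close>.\<close>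

lemma sdp_feasible_witness:
  fixes \<sigma> :: "complex ^ 'n ^ 'n"
  assumes dens: "density_operator \<sigma>" and l: "0 < l"
    and v: "v \<noteq> 0" "\<sigma> *v v = complex_of_real l *s v"
  defines "c \<equiv> 1 / (l * (norm v)\<^sup>2)"
  defines "Z \<equiv> tensor_mat \<sigma> (\<chi> i j. complex_of_real c * cnj (v $ i) * v $ j)"
  shows "Z \<in> sdp_feasible \<sigma>" and "trace Z = complex_of_real (1 / l)"
proof -
  let ?P = "\<chi> i j. complex_of_real c * cnj (v $ i) * v $ j"
  have "trace ?P = complex_of_real c * cinner_vec v v"
    by (simp add: trace_def cinner_vec_def sum_distrib_left mult_ac)
  also have "\<dots> = complex_of_real (1 / l)"
    using v(1) by (simp add: cinner_vec_self c_def)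
  finally show "trace Z = complex_of_real (1 / l)"
    using dens by (simp add: Z_def trace_tensor_mat density_operator_def)
  have "trace (?P ** transpose \<sigma>) = complex_of_real c * cinner_vec v (\<sigma> *v v)"
    by (simp add: trace_def matrix_matrix_mult_def transpose_def cinner_vec_matrix
        sum_distrib_left mult_ac)
  also have "\<dots> = 1"
    using v l by (simp add: cinner_vec_scale cinner_vec_self c_def)
  finally have "partial_trace_2 (Z ** tensor_mat (mat 1) (transpose \<sigma>)) = \<sigma>"
    by (simp add: Z_def tensor_mat_mult partial_trace_2_tensor_mat vec_eq_iff)
  \<comment> \<open>The witness meets the constraint with equality, so the difference to be checked
    is the zero matrix.\<close>
  moreover have "psd (0 :: complex ^ 'n ^ 'n)"
    by (simp add: psd_def conj_transpose_def cinner_vec_def vec_eq_iff)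
  moreover have "psd Z"
    unfolding Z_def using dens l by (intro psd_tensor_rank_one) (simp_all add: density_operator_def c_def)
  ultimately show "Z \<in> sdp_feasible \<sigma>" by (simp add: sdp_feasible_def loewner_ge_def)
qed

theorem theorem1:
  fixes \<sigma> :: "complex ^ 'n ^ 'n" and lambda_max :: real
  assumes "density_operator \<sigma>"
    and "max_eigenvalue \<sigma> lambda_max"
  shows "sdp_value \<sigma> = ereal (1 / lambda_max)"
proof (rule antisym)
  have pos: "0 < lambda_max" using max_eigenvalue_density_pos[OF assms] .
  obtain v where v: "v \<noteq> 0" "\<sigma> *v v = complex_of_real lambda_max *s v"
    using assms(2) by (auto simp: max_eigenvalue_def eigenvalue_def)
  show "sdp_value \<sigma> \<le> ereal (1 / lambda_max)"
    unfolding sdp_value_def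
    by (rule INF_lower2[OF sdp_feasible_witness(1)[OF assms(1) pos v]])
       (simp only: sdp_feasible_witness(2)[OF assms(1) pos v] Re_complex_of_real order.refl)
  show "ereal (1 / lambda_max) \<le> sdp_value \<sigma>"
    unfolding sdp_value_def
    using sdp_feasible_trace_ge[OF assms] pos by (intro INF_greatest) (simp add: field_simps)
qed

end
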